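(* Let $n\ge 1$, let $C$ be an $n\times n$ Hermitian circulant matrix with eigenvalues $\lambda_1(C)\ge\dots\ge\lambda_n(C)$, and let $D$ be an $n\times n$ real diagonal matrix with eigenvalues $\lambda_1(D)\ge\dots\ge\lambda_n(D)$. Let $\lambda_1(C+D)$ denote the largest eigenvalue of $C+D$. If the integers $k,k'$ satisfy $1\le k,k'\le n$ and $kk'<n$, then $$\lambda_1(C+D)\le \lambda_1(C)+\lambda_1(D)-\frac12\min\{\lambda_1(D)-\lambda_k(D),\ \lambda_1(C)-\lambda_{k'}(C)\}\left(1-\sqrt{\frac{kk'}{n}}\right)^2.$$
   Context: An $n\times n$ complex matrix $C$ is a circulant if its $(i,j)$ entry depends only on $i-j$ modulo $n$. Eigenvalues are listed with multiplicity in non-increasing order. *)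

theory Defs
  imports
    "Jordan_Normal_Form.Schur_Decomposition"
    "HOL-Computational_Algebra.Fundamental_Theorem_Algebra"
begin

definition hermitian_mat :: "complex mat \<Rightarrow> bool" where
  "hermitian_mat A \<longleftrightarrow> square_mat A \<and> mat_adjoint A = A"

definition circulant_mat :: "complex mat \<Rightarrow> bool" where
  "circulant_mat A \<longleftrightarrow> square_mat A \<and>
     (\<forall>i<dim_row A. \<forall>j<dim_row A. \<forall>i'<dim_row A. \<forall>j'<dim_row A.
        (int i - int j) mod int (dim_row A) = (int i' - int j') mod int (dim_row A)
        \<longrightarrow> A $$ (i, j) = A $$ (i', j'))"

definition real_diagonal_mat :: "complex mat \<Rightarrow> bool" where
  "real_diagonal_mat A \<longleftrightarrow> square_mat A \<and> diagonal_mat A \<and> (\<forall>i<dim_row A. A $$ (i, i) \<in> \<real>)"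

text \<open>
  The roots of the characteristic polynomial, with multiplicity, in non-increasing order.
  Taking real parts loses nothing for the matrices of interest: the eigenvalues of a
  Hermitian matrix are real (see \<open>of_real_desc_eigenvalues\<close> below).  For other
  matrices the list has no intended meaning.
\<close>
definition desc_eigenvalues :: "complex mat \<Rightarrow> real list" where
  "desc_eigenvalues A = rev (sorted_list_of_multiset (image_mset Re (proots (char_poly A))))"

text \<open>The index is 1-based: \<open>eig 1 A\<close> is the largest eigenvalue.\<close>
definition eig :: "nat \<Rightarrow> complex mat \<Rightarrow> real" where
  "eig k A = desc_eigenvalues A ! (k - 1)"

lemma length_desc_eigenvalues:
  assumes "A \<in> carrier_mat n n"
  shows "length (desc_eigenvalues A) = n"
proof -
  have "length (desc_eigenvalues A) = size (proots (char_poly A))"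
    unfolding desc_eigenvalues_def
    by (metis length_rev mset_sorted_list_of_multiset size_image_mset size_mset)
  thus ?thesis using degree_monic_char_poly[OF assms] by (simp add: size_proots_complex)
qed

lemma sorted_desc_eigenvalues: "sorted_wrt (\<ge>) (desc_eigenvalues A)"
  unfolding desc_eigenvalues_def by (simp add: sorted_wrt_rev)

lemma hermitian_mat_entry:
  assumes "hermitian_mat A" "i < dim_row A" "j < dim_row A"
  shows "A $$ (j, i) = cnj (A $$ (i, j))"
proof -
  have sq: "dim_col A = dim_row A" using assms(1) by (simp add: hermitian_mat_def)
  have "A $$ (j, i) = mat_adjoint A $$ (j, i)" using assms(1) by (simp add: hermitian_mat_def)
  also have "\<dots> = cnj (A $$ (i, j))"
    unfolding mat_adjoint_def mat_of_rows_def using assms(2,3) sq by simp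
  finally show ?thesis .
qed

lemma real_diagonal_mat_hermitian:
  assumes "real_diagonal_mat A"
  shows "hermitian_mat A"
proof -
  have sq: "dim_col A = dim_row A" using assms by (simp add: real_diagonal_mat_def)
  have *: "cnj (A $$ (i, j)) = A $$ (j, i)" if "i < dim_row A" "j < dim_row A" for i j
    using assms that sq
    by (cases "i = j") (auto simp: real_diagonal_mat_def diagonal_mat_def Reals_cnj_iff)
  have "mat_adjoint A = A"
    by (rule eq_matI) (auto simp: mat_adjoint_def mat_of_rows_def sq *)
  thus ?thesis using sq by (simp add: hermitian_mat_def)
qed

lemma hermitian_mat_eigenvalue_real:
  assumes "hermitian_mat A" "eigenvalue A x"
  shows "x \<in> \<real>"
proof -
  define n where "n = dim_row A"
  have sq: "dim_col A = n" using assms(1) by (simp add: hermitian_mat_def n_def)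
  obtain v where v: "v \<in> carrier_vec n" "v \<noteq> 0\<^sub>v n" "A *\<^sub>v v = x \<cdot>\<^sub>v v"
    using assms(2) by (auto simp: eigenvalue_def eigenvector_def n_def)
  have dv: "dim_vec v = n" using v(1) by simp
  define s where "s = (\<Sum>i<n. cnj (v $ i) * v $ i)"
  define q where "q = (\<Sum>i<n. \<Sum>j<n. cnj (v $ i) * (A $$ (i, j) * v $ j))"
  have row: "(\<Sum>j<n. A $$ (i, j) * v $ j) = x * v $ i" if "i < n" for i
  proof -
    have "(A *\<^sub>v v) $ i = (\<Sum>j<n. A $$ (i, j) * v $ j)"
      using that sq dv by (simp add: scalar_prod_def n_def atLeast0LessThan)
    thus ?thesis using v(3) that dv by simp
  qed
  have "q = (\<Sum>i<n. cnj (v $ i) * (x * v $ i))"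
    unfolding q_def by (intro sum.cong refl) (simp add: row flip: sum_distrib_left)
  hence qs: "q = x * s" by (simp add: s_def sum_distrib_left mult_ac)
  have "cnj q = (\<Sum>i<n. \<Sum>j<n. cnj (v $ j) * (A $$ (j, i) * v $ i))"
    unfolding q_def cnj_sum
  proof (intro sum.cong refl)
    fix i j assume "i \<in> {..<n}" "j \<in> {..<n}"
    hence "A $$ (j, i) = cnj (A $$ (i, j))"
      using hermitian_mat_entry[OF assms(1), of i j] by (simp add: n_def)
    thus "cnj (cnj (v $ i) * (A $$ (i, j) * v $ j)) = cnj (v $ j) * (A $$ (j, i) * v $ i)"
      by simp
  qed
  also have "\<dots> = q" unfolding q_def by (rule sum.swap)
  finally have qr: "cnj q = q" .
  have s: "s = of_real (\<Sum>i<n. (cmod (v $ i))\<^sup>2)"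
    unfolding s_def of_real_sum
    by (intro sum.cong refl) (metis complex_norm_square mult.commute)
  obtain i where i: "i < n" "v $ i \<noteq> 0"
    using v(1,2) dv by (metis eq_vecI index_zero_vec)
  have "(\<Sum>i<n. (cmod (v $ i))\<^sup>2) > 0"
    using i by (intro sum_pos2[of _ i]) auto
  hence "s \<noteq> 0" using s by (metis less_irrefl of_real_eq_0_iff)
  moreover have "cnj x * s = x * s" using qr unfolding qs by (simp add: s)
  ultimately show ?thesis by (simp add: Reals_cnj_iff)
qed

lemma of_real_desc_eigenvalues:
  assumes "hermitian_mat A"
  shows "mset (map complex_of_real (desc_eigenvalues A)) = proots (char_poly A)"
proof -
  have A: "A \<in> carrier_mat (dim_row A) (dim_row A)"
    using assms by (auto simp: hermitian_mat_def)
  have nz: "char_poly A \<noteq> 0" using degree_monic_char_poly[OF A] by auto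
  have "complex_of_real (Re x) = x" if "x \<in># proots (char_poly A)" for x
    using that nz hermitian_mat_eigenvalue_real[OF assms] eigenvalue_root_char_poly[OF A] by auto
  hence "image_mset (complex_of_real \<circ> Re) (proots (char_poly A)) = image_mset id (proots (char_poly A))"
    by (intro image_mset_cong) simp
  thus ?thesis by (simp add: desc_eigenvalues_def multiset.map_comp)
qed

end

theory Submission
  imports Defs "HOL-Analysis.L2_Norm"
begin

text \<open>
  Let \<open>v\<close> be an eigenvector of \<open>C + D\<close> for its largest eigenvalue.  By itself,
  \<open>\<langle>v, D v\<rangle>\<close> can be as large as \<open>\<lambda>\<^sub>1(D) \<parallel>v\<parallel>\<^sup>2\<close>, but only if \<open>v\<close> lives on the coordinates where
  \<open>D\<close> is large: fewer than \<open>k\<close> diagonal entries exceed \<open>\<lambda>\<^sub>k(D)\<close>, and the part of \<open>v\<close>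
  outside this set \<open>S\<close> of coordinates costs at least the gap \<open>\<lambda>\<^sub>1(D) - \<lambda>\<^sub>k(D)\<close> per unit of its
  squared norm.  The same holds for \<open>C\<close> and a set \<open>T\<close> of fewer than \<open>k'\<close> vectors of its
  eigenbasis.  Both are instances of \<open>rayleigh_gap_bound\<close>.

  The two eigenbases are the standard basis and, since \<open>C\<close> is a circulant, the Fourier basis
  (\<open>circulant_mult_fourier\<close>).  These are mutually unbiased: every Fourier vector has all its
  entries of modulus \<open>1 / sqrt n\<close>.  Hence \<open>v\<close> cannot be concentrated on \<open>S\<close> and on \<open>T\<close>
  simultaneously.  Precisely, \<open>uncertainty\<close> bounds the sum of the two concentrated parts by
  \<open>(1 + s) \<parallel>v\<parallel>\<^sup>2\<close> with \<open>s = sqrt (k k' / n)\<close>, so the two remaining parts have total squared norm at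
  least \<open>(1 - s) \<parallel>v\<parallel>\<^sup>2\<close>.  Thus the smaller of the two gaps is paid at least \<open>1 - s\<close> times,
  and \<open>1 - s \<ge> (1 - s)\<^sup>2 / 2\<close> because \<open>0 \<le> s \<le> 1\<close>.
\<close>

section \<open>Orthonormal bases\<close>

definition energy :: "nat set \<Rightarrow> (nat \<Rightarrow> complex) \<Rightarrow> real" where
  "energy S x = (\<Sum>i\<in>S. (cmod (x i))\<^sup>2)"

text \<open>
  Vectors and bases are functions on indices, so that inner products are plain finite sums;
  matrices appear only where an inverse or a characteristic polynomial is involved.
\<close>

definition orthonormal_columns :: "nat \<Rightarrow> (nat \<Rightarrow> nat \<Rightarrow> complex) \<Rightarrow> bool" where
  "orthonormal_columns n W \<longleftrightarrow>
     (\<forall>j<n. \<forall>l<n. (\<Sum>i<n. cnj (W i j) * W i l) = (if j = l then 1 else 0))"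

lemma energy_nonneg: "energy S x \<ge> 0"
  by (simp add: energy_def sum_nonneg)

lemma energy_mono: "finite T \<Longrightarrow> S \<subseteq> T \<Longrightarrow> energy S x \<le> energy T x"
  unfolding energy_def by (rule sum_mono2) auto

lemma energy_complement:
  "finite T \<Longrightarrow> S \<subseteq> T \<Longrightarrow> energy (T - S) x = energy T x - energy S x"
  unfolding energy_def by (rule sum_diff)

lemma energy_restrict:
  "finite T \<Longrightarrow> S \<subseteq> T \<Longrightarrow> energy T (\<lambda>i. if i \<in> S then x i else 0) = energy S x"
  unfolding energy_def by (rule sum.mono_neutral_cong_right) auto

lemma energy_eq_inner: "complex_of_real (energy S x) = (\<Sum>i\<in>S. cnj (x i) * x i)"
  unfolding energy_def of_real_sum
  by (intro sum.cong refl) (metis complex_norm_square mult.commute)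

lemma inner_restrict:
  assumes "finite T" "S \<subseteq> T"
  shows "(\<Sum>i\<in>T. cnj (x i) * (if i \<in> S then x i else 0)) = complex_of_real (energy S x)"
  unfolding energy_eq_inner using assms by (intro sum.mono_neutral_cong_right) auto

lemma cmod_sum_mult_le:
  "cmod (\<Sum>i\<in>S. f i * g i) \<le> sqrt (\<Sum>i\<in>S. (cmod (f i))\<^sup>2) * sqrt (\<Sum>i\<in>S. (cmod (g i))\<^sup>2)"
proof -
  have "cmod (\<Sum>i\<in>S. f i * g i) \<le> (\<Sum>i\<in>S. \<bar>cmod (f i)\<bar> * \<bar>cmod (g i)\<bar>)"
    by (rule order.trans[OF norm_sum]) (simp add: norm_mult)
  also have "\<dots> \<le> sqrt (\<Sum>i\<in>S. (cmod (f i))\<^sup>2) * sqrt (\<Sum>i\<in>S. (cmod (g i))\<^sup>2)"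
    using L2_set_mult_ineq[of "\<lambda>i. cmod (f i)" "\<lambda>i. cmod (g i)" S] by (simp add: L2_set_def)
  finally show ?thesis .
qed

lemma parseval:
  assumes "orthonormal_columns n W"
  shows "(\<Sum>i<n. cnj (\<Sum>j<n. W i j * x j) * (\<Sum>l<n. W i l * y l)) = (\<Sum>j<n. cnj (x j) * y j)"
proof -
  have "(\<Sum>i<n. cnj (\<Sum>j<n. W i j * x j) * (\<Sum>l<n. W i l * y l))
      = (\<Sum>i<n. \<Sum>j<n. \<Sum>l<n. cnj (x j) * y l * (cnj (W i j) * W i l))"
    unfolding cnj_sum complex_cnj_mult sum_product
    by (intro sum.cong refl) (simp only: mult_ac)
  also have "\<dots> = (\<Sum>j<n. \<Sum>i<n. \<Sum>l<n. cnj (x j) * y l * (cnj (W i j) * W i l))"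
    by (rule sum.swap)
  also have "\<dots> = (\<Sum>j<n. \<Sum>l<n. \<Sum>i<n. cnj (x j) * y l * (cnj (W i j) * W i l))"
    by (intro sum.cong refl sum.swap)
  also have "\<dots> = (\<Sum>j<n. \<Sum>l<n. cnj (x j) * y l * (\<Sum>i<n. cnj (W i j) * W i l))"
    by (simp add: sum_distrib_left)
  also have "\<dots> = (\<Sum>j<n. \<Sum>l<n. if j = l then cnj (x j) * y l else 0)"
    using assms by (intro sum.cong refl) (auto simp: orthonormal_columns_def)
  also have "\<dots> = (\<Sum>j<n. cnj (x j) * y j)"
    by (intro sum.cong refl) simp
  finally show ?thesis .
qed

lemma energy_isometry:
  assumes "orthonormal_columns n W"
  shows "energy {..<n} (\<lambda>i. \<Sum>j<n. W i j * x j) = energy {..<n} x"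
proof -
  have "complex_of_real (energy {..<n} (\<lambda>i. \<Sum>j<n. W i j * x j)) = of_real (energy {..<n} x)"
    unfolding energy_eq_inner by (rule parseval[OF assms])
  thus ?thesis by (simp only: of_real_eq_iff)
qed

text \<open>
  For square matrices a left inverse is a right inverse.  This is where finiteness of the
  dimension enters: orthonormality of \<open>n\<close> columns gives orthonormality of the rows, hence
  completeness of the basis.
\<close>

lemma orthonormal_columns_inverse:
  assumes W: "orthonormal_columns n W"
  shows "mat n n (\<lambda>(i, j). cnj (W j i)) * mat n n (\<lambda>(i, j). W i j) = 1\<^sub>m n"
    and "mat n n (\<lambda>(i, j). W i j) * mat n n (\<lambda>(i, j). cnj (W j i)) = 1\<^sub>m n"
proof -
  show 1: "mat n n (\<lambda>(i, j). cnj (W j i)) * mat n n (\<lambda>(i, j). W i j) = 1\<^sub>m n"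
    using W by (intro eq_matI)
      (auto simp: scalar_prod_def orthonormal_columns_def atLeast0LessThan)
  show "mat n n (\<lambda>(i, j). W i j) * mat n n (\<lambda>(i, j). cnj (W j i)) = 1\<^sub>m n"
    by (rule mat_mult_left_right_inverse[OF _ _ 1]) auto
qed

lemma orthonormal_columns_expansion:
  assumes W: "orthonormal_columns n W" and i: "i < n"
  shows "v i = (\<Sum>j<n. W i j * (\<Sum>l<n. cnj (W l j) * v l))"
proof -
  have rows: "(\<Sum>j<n. W i j * cnj (W l j)) = (if i = l then 1 else 0)" if "l < n" for l
    using arg_cong[OF orthonormal_columns_inverse(2)[OF W], of "\<lambda>M. M $$ (i, l)"] i that
    by (simp add: scalar_prod_def atLeast0LessThan)
  have "(\<Sum>j<n. W i j * (\<Sum>l<n. cnj (W l j) * v l)) = (\<Sum>j<n. \<Sum>l<n. W i j * cnj (W l j) * v l)"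
    by (simp add: sum_distrib_left mult_ac)
  also have "\<dots> = (\<Sum>l<n. \<Sum>j<n. W i j * cnj (W l j) * v l)" by (rule sum.swap)
  also have "\<dots> = (\<Sum>l<n. if i = l then v l else 0)"
    by (intro sum.cong refl) (simp add: rows flip: sum_distrib_right)
  also have "\<dots> = v i" using i by simp
  finally show ?thesis by simp
qed

section \<open>An uncertainty principle\<close>

text \<open>
  Let \<open>P\<close> restrict a vector to the coordinates in \<open>S\<close>, let \<open>Q\<close> project onto the columns of
  \<open>W\<close> indexed by \<open>T\<close>, and put \<open>X = \<parallel>P v\<parallel>\<^sup>2 + \<parallel>Q v\<parallel>\<^sup>2\<close>.  Then \<open>X = \<langle>v, P v + Q v\<rangle>\<close>, so that
  \<open>X\<^sup>2 \<le> \<parallel>v\<parallel>\<^sup>2 \<parallel>P v + Q v\<parallel>\<^sup>2\<close>.  The cross term \<open>\<langle>P v, Q v\<rangle>\<close> involves only the entries of \<open>W\<close> in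
  the block \<open>S \<times> T\<close>, whose Hilbert-Schmidt norm is at most \<open>s = sqrt (\<mu> |S| |T|)\<close>; therefore
  \<open>\<parallel>P v + Q v\<parallel>\<^sup>2 \<le> X + 2 s \<parallel>P v\<parallel> \<parallel>Q v\<parallel> \<le> (1 + s) X\<close>.  Cancelling \<open>X\<close> gives the bound.
\<close>

lemma uncertainty:
  assumes W: "orthonormal_columns n W"
    and v: "\<And>i. i < n \<Longrightarrow> v i = (\<Sum>j<n. W i j * z j)"
    and S: "S \<subseteq> {..<n}" and T: "T \<subseteq> {..<n}"
    and \<mu>: "\<And>i j. i < n \<Longrightarrow> j < n \<Longrightarrow> (cmod (W i j))\<^sup>2 \<le> \<mu>"
  shows "energy S v + energy T z \<le> (1 + sqrt (\<mu> * real (card S * card T))) * energy {..<n} v"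
proof -
  define s where "s = sqrt (\<mu> * real (card S * card T))"
  define N where "N = energy {..<n} v"
  define a where "a = energy S v"
  define b where "b = energy T z"
  define p where "p = (\<lambda>i. if i \<in> S then v i else 0)"
  define x where "x = (\<lambda>j. if j \<in> T then z j else 0)"
  define q where "q = (\<lambda>i. \<Sum>j<n. W i j * x j)"
  have fin: "finite S" "finite T" using S T finite_subset by auto
  have a0: "a \<ge> 0" and b0: "b \<ge> 0" by (auto simp: a_def b_def energy_nonneg)
  have vp: "(\<Sum>i<n. cnj (v i) * p i) = of_real a"
    unfolding p_def a_def by (rule inner_restrict) (use S in auto)
  have pp: "energy {..<n} p = a"
    unfolding p_def a_def by (rule energy_restrict) (use S in auto)
  have vq: "(\<Sum>i<n. cnj (v i) * q i) = of_real b"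
  proof -
    have "(\<Sum>i<n. cnj (v i) * q i) = (\<Sum>i<n. cnj (\<Sum>j<n. W i j * z j) * (\<Sum>j<n. W i j * x j))"
      by (intro sum.cong refl) (simp add: v q_def)
    also have "\<dots> = (\<Sum>j<n. cnj (z j) * x j)" by (rule parseval[OF W])
    also have "\<dots> = of_real b" unfolding x_def b_def by (rule inner_restrict) (use T in auto)
    finally show ?thesis .
  qed
  have qq: "energy {..<n} q = b"
    unfolding q_def energy_isometry[OF W] unfolding x_def b_def
    by (rule energy_restrict) (use T in auto)
  have pq: "cmod (\<Sum>i<n. cnj (p i) * q i) \<le> s * sqrt (a * b)"
  proof -
    have "(\<Sum>i<n. cnj (p i) * q i) = (\<Sum>i\<in>S. cnj (v i) * q i)"
      using S by (intro sum.mono_neutral_cong_right) (auto simp: p_def)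
    also have "\<dots> = (\<Sum>i\<in>S. \<Sum>j\<in>T. W i j * (cnj (v i) * z j))"
    proof (intro sum.cong refl)
      fix i
      have "q i = (\<Sum>j\<in>T. W i j * z j)"
        unfolding q_def using T by (intro sum.mono_neutral_cong_right) (auto simp: x_def)
      thus "cnj (v i) * q i = (\<Sum>j\<in>T. W i j * (cnj (v i) * z j))"
        by (simp add: sum_distrib_left mult_ac)
    qed
    also have "\<dots> = (\<Sum>(i, j)\<in>S \<times> T. W i j * (cnj (v i) * z j))"
      by (rule sum.cartesian_product)
    also have "\<dots> = (\<Sum>r\<in>S \<times> T. W (fst r) (snd r) * (cnj (v (fst r)) * z (snd r)))"
      by (simp add: case_prod_beta)
    finally have eq: "(\<Sum>i<n. cnj (p i) * q i) = \<dots>" .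
    have 1: "(\<Sum>r\<in>S \<times> T. (cmod (W (fst r) (snd r)))\<^sup>2) \<le> \<mu> * real (card S * card T)"
    proof -
      have "(\<Sum>r\<in>S \<times> T. (cmod (W (fst r) (snd r)))\<^sup>2) \<le> of_nat (card (S \<times> T)) * \<mu>"
        using S T by (intro sum_bounded_above \<mu>) auto
      thus ?thesis by (simp add: card_cartesian_product mult_ac)
    qed
    have 2: "(\<Sum>r\<in>S \<times> T. (cmod (cnj (v (fst r)) * z (snd r)))\<^sup>2) = a * b"
      unfolding a_def b_def energy_def sum_product sum.cartesian_product
      by (simp add: norm_mult power_mult_distrib case_prod_beta)
    have "cmod (\<Sum>i<n. cnj (p i) * q i)
        \<le> sqrt (\<Sum>r\<in>S \<times> T. (cmod (W (fst r) (snd r)))\<^sup>2)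
          * sqrt (\<Sum>r\<in>S \<times> T. (cmod (cnj (v (fst r)) * z (snd r)))\<^sup>2)"
      unfolding eq by (rule cmod_sum_mult_le)
    also have "\<dots> \<le> s * sqrt (a * b)"
      unfolding 2 s_def using 1 a0 b0 by (intro mult_right_mono real_sqrt_le_mono) auto
    finally show ?thesis .
  qed
  \<comment> \<open>\<open>\<mu>\<close> is nonnegative because it bounds the square of some entry, provided there is one.\<close>
  have "\<mu> * real (card S * card T) \<ge> 0"
  proof (cases "S = {} \<or> T = {}")
    case False
    then obtain i j where "i < n" "j < n" using S T by blast
    hence "\<mu> \<ge> 0" using \<mu>[of i j] by (meson order.trans zero_le_power2)
    thus ?thesis by simp
  qed auto
  hence s0: "s \<ge> 0" by (simp add: s_def)
  \<comment> \<open>The arithmetic-geometric mean inequality turns the cross term into a multiple of \<open>a + b\<close>.\<close>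
  have "sqrt (a * b) \<le> (a + b) / 2"
    using a0 b0 by (rule arith_geo_mean_sqrt)
  hence "s * sqrt (a * b) \<le> s * ((a + b) / 2)" using s0 by (intro mult_left_mono)
  with pq have re: "2 * Re (\<Sum>i<n. cnj (p i) * q i) \<le> s * (a + b)"
    using complex_Re_le_cmod[of "\<Sum>i<n. cnj (p i) * q i"] by simp
  have "energy {..<n} (\<lambda>i. p i + q i)
      = energy {..<n} p + energy {..<n} q + 2 * Re (\<Sum>i<n. cnj (p i) * q i)"
  proof -
    have "(cmod (x + y))\<^sup>2 = (cmod x)\<^sup>2 + (cmod y)\<^sup>2 + 2 * Re (cnj x * y)" for x y
      unfolding cmod_power2 by (simp add: power2_eq_square algebra_simps)
    thus ?thesis unfolding energy_def by (simp add: sum.distrib sum_distrib_left)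
  qed
  with re pp qq have le: "energy {..<n} (\<lambda>i. p i + q i) \<le> (1 + s) * (a + b)"
    by (simp add: algebra_simps)
  have "(\<Sum>i<n. cnj (v i) * (p i + q i)) = of_real (a + b)"
    using vp vq by (simp add: ring_distribs sum.distrib)
  hence "\<bar>a + b\<bar> = cmod (\<Sum>i<n. cnj (v i) * (p i + q i))" by (simp only: norm_of_real)
  also have "\<dots> \<le> sqrt N * sqrt (energy {..<n} (\<lambda>i. p i + q i))"
    using cmod_sum_mult_le[of "\<lambda>i. cnj (v i)" "\<lambda>i. p i + q i" "{..<n}"]
    by (simp add: N_def energy_def)
  also have "\<dots> \<le> sqrt N * sqrt ((1 + s) * (a + b))"
    using le by (intro mult_left_mono real_sqrt_le_mono) (auto simp: N_def energy_nonneg)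
  finally have "\<bar>a + b\<bar> \<le> sqrt (N * ((1 + s) * (a + b)))" by (simp add: real_sqrt_mult)
  hence "(a + b)\<^sup>2 \<le> N * ((1 + s) * (a + b))"
    by (rule sqrt_ge_absD)
  hence "(a + b) * (a + b) \<le> (a + b) * ((1 + s) * N)"
    by (simp add: power2_eq_square algebra_simps)
  moreover have "(1 + s) * N \<ge> 0" using s0 by (simp add: N_def energy_nonneg)
  ultimately have "a + b \<le> (1 + s) * N"
    using a0 b0 by (cases "a + b = 0") (auto simp: mult_le_cancel_left)
  thus ?thesis by (simp add: a_def b_def s_def N_def)
qed

section \<open>Eigenvalues and Rayleigh quotients\<close>

text \<open>
  An orthonormal eigenbasis is a similarity with a diagonal matrix, so it accounts for the
  spectrum with the correct multiplicities.
\<close>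

lemma proots_char_poly_orthonormal_eigenbasis:
  assumes A: "A \<in> carrier_mat n n" and W: "orthonormal_columns n W"
    and eig: "\<And>i j. i < n \<Longrightarrow> j < n \<Longrightarrow> (\<Sum>l<n. A $$ (i, l) * W l j) = c j * W i j"
  shows "proots (char_poly A) = image_mset c (mset [0..<n])"
proof -
  define P where "P = mat n n (\<lambda>(i, j). W i j)"
  define Q where "Q = mat n n (\<lambda>(i, j). cnj (W j i))"
  define B where "B = mat n n (\<lambda>(i, j). if i = j then c i else 0)"
  have carr: "P \<in> carrier_mat n n" "Q \<in> carrier_mat n n" "B \<in> carrier_mat n n"
    by (auto simp: P_def Q_def B_def)
  have QP: "Q * P = 1\<^sub>m n" and PQ: "P * Q = 1\<^sub>m n"
    unfolding P_def Q_def by (rule orthonormal_columns_inverse[OF W])+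
  have "A * P = P * B"
  proof (rule eq_matI)
    fix i j assume "i < dim_row (P * B)" "j < dim_col (P * B)"
    hence ij: "i < n" "j < n" using carr by auto
    have "(A * P) $$ (i, j) = (\<Sum>l<n. A $$ (i, l) * W l j)"
      using ij A by (simp add: P_def scalar_prod_def atLeast0LessThan)
    also have "\<dots> = c j * W i j" using eig ij by simp
    also have "\<dots> = (\<Sum>l<n. if l = j then W i l * c l else 0)" using ij by simp
    also have "\<dots> = (P * B) $$ (i, j)"
      using ij by (simp add: P_def B_def scalar_prod_def atLeast0LessThan if_distrib cong: if_cong)
    finally show "(A * P) $$ (i, j) = (P * B) $$ (i, j)" .
  qed (use A carr in auto)
  hence "P * B * Q = A * P * Q" by simp
  also have "\<dots> = A" using A carr PQ by (simp add: assoc_mult_mat[of A n n P n Q n])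
  finally have "A = P * B * Q" by simp
  hence "similar_mat A B" using PQ QP A carr by (intro similar_matI[of _ _ P Q n]) auto
  hence "char_poly A = char_poly B" by (rule char_poly_similar)
  also have "\<dots> = (\<Prod>a\<leftarrow>diag_mat B. [:- a, 1:])"
    by (rule char_poly_upper_triangular[OF carr(3)]) (auto simp: B_def)
  also have "diag_mat B = map c [0..<n]"
    by (auto simp: diag_mat_def B_def)
  finally have prod: "char_poly A = (\<Prod>a\<leftarrow>map c [0..<n]. [:- a, 1:])" .
  have roots: "proots (\<Prod>a\<leftarrow>as. [:- a, 1:]) = mset as" for as :: "complex list"
  proof (induction as)
    case (Cons a as)
    have "(\<Prod>a\<leftarrow>as. [:- a, 1:]) \<noteq> 0" by (auto simp: prod_list_zero_iff)
    thus ?case using Cons by (simp add: proots_mult del: mult_pCons_left mult_pCons_right)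
  qed simp
  show ?thesis unfolding prod roots by simp
qed

lemma eig_one_ge:
  assumes "\<alpha> \<in># mset (desc_eigenvalues A)"
  shows "\<alpha> \<le> eig 1 A"
proof -
  obtain m where m: "m < length (desc_eigenvalues A)" "\<alpha> = desc_eigenvalues A ! m"
    using assms by (auto simp: in_set_conv_nth)
  show ?thesis
  proof (cases "m = 0")
    case False
    thus ?thesis using m sorted_wrt_nth_less[OF sorted_desc_eigenvalues, of 0 m A] by (simp add: eig_def)
  qed (simp add: m eig_def)
qed

lemma eig_antimono:
  assumes "A \<in> carrier_mat n n" "1 \<le> k" "k \<le> n"
  shows "eig k A \<le> eig 1 A"
  using assms by (intro eig_one_ge) (auto simp: eig_def length_desc_eigenvalues)

text \<open>
  Counting with multiplicity, only the first \<open>k - 1\<close> entries of the non-increasing list of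
  eigenvalues can exceed its \<open>k\<close>-th entry.
\<close>

lemma card_above_eig:
  assumes A: "A \<in> carrier_mat n n" and k: "1 \<le> k" "k \<le> n"
    and spec: "mset (desc_eigenvalues A) = image_mset f (mset [0..<n])"
  shows "card {j. j < n \<and> f j > eig k A} < k"
proof -
  let ?L = "desc_eigenvalues A" and ?t = "eig k A"
  have len: "length ?L = n" by (rule length_desc_eigenvalues[OF A])
  have "card {j. j < n \<and> f j > ?t} = size (filter_mset (\<lambda>j. f j > ?t) (mset [0..<n]))"
  proof -
    have "size (filter_mset (\<lambda>j. f j > ?t) (mset [0..<n])) = length (filter (\<lambda>j. f j > ?t) [0..<n])"
      by (simp only: mset_filter[symmetric] size_mset)
    also have "\<dots> = card (set (filter (\<lambda>j. f j > ?t) [0..<n]))"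
      by (rule distinct_card[symmetric]) simp
    also have "set (filter (\<lambda>j. f j > ?t) [0..<n]) = {j. j < n \<and> f j > ?t}" by auto
    finally show ?thesis by simp
  qed
  also have "\<dots> = size (filter_mset (\<lambda>x. x > ?t) (mset ?L))"
    unfolding spec by (simp add: filter_mset_image_mset)
  also have "\<dots> = length (filter (\<lambda>x. x > ?t) ?L)"
    by (simp only: mset_filter[symmetric] size_mset)
  also have "\<dots> = card {m. m < length ?L \<and> ?L ! m > ?t}" by (rule length_filter_conv_card)
  also have "\<dots> \<le> card {..<k - 1}"
  proof (rule card_mono)
    show "{m. m < length ?L \<and> ?L ! m > ?t} \<subseteq> {..<k - 1}"
    proof (rule subsetI, rule ccontr)
      fix m assume m: "m \<in> {m. m < length ?L \<and> ?L ! m > ?t}" "m \<notin> {..<k - 1}"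
      hence "?L ! m \<le> ?L ! (k - 1)"
        using sorted_wrt_nth_less[OF sorted_desc_eigenvalues, of "k - 1" m A]
        by (cases "m = k - 1") auto
      thus False using m by (simp add: eig_def)
    qed
  qed simp
  finally show ?thesis using k by simp
qed

text \<open>
  In the eigenbasis the quadratic form is the sum of the eigenvalues with weights
  \<open>|z j|\<^sup>2\<close>.  With \<open>T\<close> the set of indices whose eigenvalue exceeds the \<open>k\<close>-th one, estimate
  the eigenvalues on \<open>T\<close> by the largest and all others by the \<open>k\<close>-th.  Defining \<open>T\<close> by this
  threshold avoids having to order the eigenbasis.
\<close>

lemma rayleigh_gap_bound:
  assumes A: "A \<in> carrier_mat n n" "hermitian_mat A" and W: "orthonormal_columns n W"
    and eig: "\<And>i j. i < n \<Longrightarrow> j < n \<Longrightarrow> (\<Sum>l<n. A $$ (i, l) * W l j) = c j * W i j"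
    and v: "\<And>i. i < n \<Longrightarrow> v i = (\<Sum>j<n. W i j * z j)"
    and k: "1 \<le> k" "k \<le> n"
  obtains T where "T \<subseteq> {..<n}" "card T < k"
    "Re (\<Sum>i<n. cnj (v i) * (\<Sum>l<n. A $$ (i, l) * v l))
      \<le> eig 1 A * energy {..<n} v - (eig 1 A - eig k A) * (energy {..<n} v - energy T z)"
proof -
  define T where "T = {j. j < n \<and> Re (c j) > eig k A}"
  have T: "T \<subseteq> {..<n}" by (auto simp: T_def)
  have spec: "mset (desc_eigenvalues A) = image_mset (\<lambda>j. Re (c j)) (mset [0..<n])"
    unfolding desc_eigenvalues_def
      proots_char_poly_orthonormal_eigenbasis[OF A(1) W eig, simplified]
    by (simp add: multiset.map_comp o_def)
  have "card T < k" unfolding T_def by (rule card_above_eig[OF A(1) k spec])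
  have top: "Re (c j) \<le> eig 1 A" if "j < n" for j
    by (rule eig_one_ge) (use that in \<open>simp add: spec\<close>)
  have Av: "(\<Sum>l<n. A $$ (i, l) * v l) = (\<Sum>j<n. W i j * (c j * z j))" if i: "i < n" for i
  proof -
    have "(\<Sum>l<n. A $$ (i, l) * v l) = (\<Sum>l<n. \<Sum>j<n. A $$ (i, l) * (W l j * z j))"
      by (intro sum.cong refl) (simp add: v sum_distrib_left)
    also have "\<dots> = (\<Sum>j<n. \<Sum>l<n. A $$ (i, l) * (W l j * z j))" by (rule sum.swap)
    also have "\<dots> = (\<Sum>j<n. (\<Sum>l<n. A $$ (i, l) * W l j) * z j)"
      by (simp add: sum_distrib_right mult.assoc)
    also have "\<dots> = (\<Sum>j<n. W i j * (c j * z j))"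
      by (intro sum.cong refl) (simp add: eig i)
    finally show ?thesis .
  qed
  have "(\<Sum>i<n. cnj (v i) * (\<Sum>l<n. A $$ (i, l) * v l))
      = (\<Sum>i<n. cnj (\<Sum>j<n. W i j * z j) * (\<Sum>j<n. W i j * (c j * z j)))"
    by (intro sum.cong refl) (simp only: lessThan_iff Av, simp add: v)
  also have "\<dots> = (\<Sum>j<n. cnj (z j) * (c j * z j))" by (rule parseval[OF W])
  also have "\<dots> = (\<Sum>j<n. c j * of_real ((cmod (z j))\<^sup>2))"
    by (intro sum.cong refl) (simp only: complex_norm_square mult_ac)
  finally have "Re (\<Sum>i<n. cnj (v i) * (\<Sum>l<n. A $$ (i, l) * v l))
      = (\<Sum>j<n. Re (c j) * (cmod (z j))\<^sup>2)" by simp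
  also have "\<dots> = (\<Sum>j\<in>{..<n} - T. Re (c j) * (cmod (z j))\<^sup>2) + (\<Sum>j\<in>T. Re (c j) * (cmod (z j))\<^sup>2)"
    by (rule sum.subset_diff[OF T]) simp
  also have "\<dots> \<le> eig k A * energy ({..<n} - T) z + eig 1 A * energy T z"
    unfolding energy_def sum_distrib_left
    by (intro add_mono sum_mono mult_right_mono) (use top in \<open>auto simp: T_def\<close>)
  also have "energy ({..<n} - T) z = energy {..<n} z - energy T z"
    by (rule energy_complement) (use T in auto)
  also have "energy {..<n} z = energy {..<n} (\<lambda>i. \<Sum>j<n. W i j * z j)"
    by (rule energy_isometry[OF W, symmetric])
  also have "\<dots> = energy {..<n} v" by (simp add: energy_def v)
  also have "eig k A * (energy {..<n} v - energy T z) + eig 1 A * energy T z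
      = eig 1 A * energy {..<n} v - (eig 1 A - eig k A) * (energy {..<n} v - energy T z)"
    by (simp add: algebra_simps)
  finally show thesis using that T \<open>card T < k\<close> by blast
qed

section \<open>The Fourier basis diagonalises circulants\<close>

definition root_of_unity :: "nat \<Rightarrow> complex" where
  "root_of_unity n = cis (2 * pi / real n)"

definition fourier :: "nat \<Rightarrow> nat \<Rightarrow> nat \<Rightarrow> complex" where
  "fourier n i j = root_of_unity n ^ (i * j) / of_real (sqrt (real n))"

lemma root_of_unity_power_n: "n > 0 \<Longrightarrow> root_of_unity n ^ n = 1"
  by (simp add: root_of_unity_def DeMoivre)

lemma root_of_unity_mult_cnj: "root_of_unity n * cnj (root_of_unity n) = 1"
  by (simp add: root_of_unity_def cis_cnj cis_mult)

lemma root_of_unity_power_inject: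
  assumes "j < n" "l < n" "root_of_unity n ^ j = root_of_unity n ^ l"
  shows "j = l"
proof -
  have "inj_on (\<lambda>k. cis (2 * pi * real k / real n)) {..<n}"
    using bij_betw_roots_unity[of n] assms(1) by (auto simp: bij_betw_def)
  moreover have "root_of_unity n ^ m = cis (2 * pi * real m / real n)" for m
    by (simp add: root_of_unity_def DeMoivre mult_ac)
  ultimately show ?thesis using assms by (auto dest: inj_onD)
qed

lemma norm_fourier: "n > 0 \<Longrightarrow> (cmod (fourier n i j))\<^sup>2 = 1 / real n"
  by (simp add: fourier_def root_of_unity_def norm_divide norm_power power_divide)

lemma orthonormal_columns_fourier:
  assumes n: "n > 0"
  shows "orthonormal_columns n (fourier n)"
  unfolding orthonormal_columns_def
proof (intro allI impI)
  fix j l assume jl: "j < n" "l < n"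
  let ?\<omega> = "root_of_unity n"
  define x where "x = cnj (?\<omega> ^ j) * ?\<omega> ^ l"
  have pow: "?\<omega> ^ m * cnj (?\<omega> ^ m) = 1" for m
    by (simp only: complex_cnj_power power_mult_distrib[symmetric] root_of_unity_mult_cnj power_one)
  have x_power: "x ^ m = cnj (?\<omega> ^ (m * j)) * ?\<omega> ^ (m * l)" for m
    by (simp add: x_def power_mult_distrib power_mult[symmetric] mult.commute[of m])
  have s: "complex_of_real (sqrt (real n)) * of_real (sqrt (real n)) = of_nat n"
    by (simp flip: of_real_mult)
  have "(\<Sum>i<n. cnj (fourier n i j) * fourier n i l) = (\<Sum>i<n. x ^ i / of_nat n)"
    by (simp add: fourier_def x_power s)
  also have "\<dots> = (\<Sum>i<n. x ^ i) / of_nat n" by (simp add: sum_divide_distrib)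
  also have "\<dots> = (if j = l then 1 else 0)"
  proof (cases "j = l")
    case True
    hence "x = 1" using pow[of l] by (simp add: x_def mult.commute)
    thus ?thesis using n True by simp
  next
    case False
    have "x \<noteq> 1"
    proof
      assume "x = 1"
      hence "?\<omega> ^ j = ?\<omega> ^ j * (cnj (?\<omega> ^ j) * ?\<omega> ^ l)" by (simp add: x_def)
      also have "\<dots> = (?\<omega> ^ j * cnj (?\<omega> ^ j)) * ?\<omega> ^ l" by (simp only: mult.assoc)
      also have "\<dots> = ?\<omega> ^ l" unfolding pow by simp
      finally show False using root_of_unity_power_inject jl False by blast
    qed
    moreover have "x ^ n = 1" by (simp add: x_power power_mult root_of_unity_power_n n)
    ultimately show ?thesis using False by (simp add: geometric_sum)
  qed
  finally show "(\<Sum>i<n. cnj (fourier n i j) * fourier n i l) = (if j = l then 1 else 0)" .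
qed

text \<open>
  Row \<open>i\<close> of a circulant is row \<open>0\<close> shifted cyclically by \<open>i\<close>, and shifting a character of
  \<open>\<int>/n\<int>\<close> by \<open>i\<close> multiplies it by its value at \<open>i\<close>.
\<close>

lemma circulant_mult_fourier:
  assumes C: "C \<in> carrier_mat n n" "circulant_mat C" and ij: "i < n" "j < n"
  shows "(\<Sum>l<n. C $$ (i, l) * fourier n l j)
    = (\<Sum>m<n. C $$ (0, m) * root_of_unity n ^ (m * j)) * fourier n i j"
proof -
  have n: "n > 0" using ij by simp
  let ?s = "\<lambda>m. (m + i) mod n"
  have unshift: "((m + a) mod n + b) mod n = m" if "m < n" "a + b = n" for m a b
    using that by (simp add: mod_add_left_eq add.assoc)
  have bij: "bij_betw ?s {..<n} {..<n}"
    by (rule bij_betw_byWitness[where f' = "\<lambda>l. (l + (n - i)) mod n"])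
      (use ij unshift[of _ i "n - i"] unshift[of _ "n - i" i] in auto)
  have shift: "fourier n (?s m) j = root_of_unity n ^ (m * j) * fourier n i j" for m
  proof -
    have "(root_of_unity n ^ n) ^ (j * ((m + i) div n)) = 1"
      by (simp add: root_of_unity_power_n n)
    hence "root_of_unity n ^ (?s m * j)
        = root_of_unity n ^ (?s m * j + n * (j * ((m + i) div n)))"
      by (simp add: power_add power_mult)
    also have "?s m * j + n * (j * ((m + i) div n)) = (?s m + n * ((m + i) div n)) * j"
      by (simp only: distrib_right mult.assoc mult.commute[of j])
    also have "?s m + n * ((m + i) div n) = m + i" by simp
    finally show ?thesis by (simp add: fourier_def algebra_simps power_add)
  qed
  have entry: "C $$ (i, ?s m) = C $$ (0, m)" if "m < n" for m
  proof -
    have "(int i - int (?s m)) mod int n = (int 0 - int m) mod int n"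
      by (simp add: zmod_int mod_simps)
    moreover have "?s m < n" using n by simp
    ultimately show ?thesis using C ij n that unfolding circulant_mat_def by auto
  qed
  have "(\<Sum>l<n. C $$ (i, l) * fourier n l j) = (\<Sum>m<n. C $$ (i, ?s m) * fourier n (?s m) j)"
    by (rule sum.reindex_bij_betw[OF bij, symmetric])
  also have "\<dots> = (\<Sum>m<n. C $$ (0, m) * root_of_unity n ^ (m * j) * fourier n i j)"
    by (intro sum.cong refl) (simp add: entry shift)
  finally show ?thesis by (simp add: sum_distrib_right)
qed

section \<open>The largest eigenvalue of the sum\<close>

lemma eig_one_eigenvector:
  assumes A: "A \<in> carrier_mat n n" "hermitian_mat A" and n: "n > 0"
  obtains v where "energy {..<n} v > 0"
    "\<And>i. i < n \<Longrightarrow> (\<Sum>l<n. A $$ (i, l) * v l) = complex_of_real (eig 1 A) * v i"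
proof -
  have "eig 1 A \<in> set (desc_eigenvalues A)"
    using n A by (simp add: eig_def length_desc_eigenvalues)
  hence "complex_of_real (eig 1 A) \<in># mset (map complex_of_real (desc_eigenvalues A))"
    by simp
  hence "complex_of_real (eig 1 A) \<in># proots (char_poly A)"
    unfolding of_real_desc_eigenvalues[OF A(2)] .
  moreover have "char_poly A \<noteq> 0" using degree_monic_char_poly[OF A(1)] by auto
  ultimately have "eigenvalue A (complex_of_real (eig 1 A))"
    by (simp add: eigenvalue_root_char_poly[OF A(1)])
  then obtain w where w: "w \<in> carrier_vec n" "w \<noteq> 0\<^sub>v n"
      "A *\<^sub>v w = complex_of_real (eig 1 A) \<cdot>\<^sub>v w"
    using A by (auto simp: eigenvalue_def eigenvector_def)
  obtain i where "i < n" "w $ i \<noteq> 0"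
    using w(1,2) by (metis carrier_vecD eq_vecI index_zero_vec)
  hence "energy {..<n} (\<lambda>i. w $ i) > 0"
    unfolding energy_def by (intro sum_pos2[of _ i]) auto
  moreover have "(\<Sum>l<n. A $$ (i, l) * w $ l) = complex_of_real (eig 1 A) * w $ i" if "i < n" for i
  proof -
    have "(A *\<^sub>v w) $ i = (\<Sum>l<n. A $$ (i, l) * w $ l)"
      using that A(1) w(1) by (auto simp: scalar_prod_def atLeast0LessThan)
    thus ?thesis using w(1,3) that by simp
  qed
  ultimately show thesis using that by blast
qed

lemma hermitian_mat_add:
  assumes "A \<in> carrier_mat n n" "B \<in> carrier_mat n n" "hermitian_mat A" "hermitian_mat B"
  shows "hermitian_mat (A + B)"
proof -
  have "cnj (A $$ (j, i)) = A $$ (i, j)" "cnj (B $$ (j, i)) = B $$ (i, j)" if "i < n" "j < n" for i j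
    using hermitian_mat_entry[OF assms(3), of j i] hermitian_mat_entry[OF assms(4), of j i] assms(1,2) that
    by auto
  hence "mat_adjoint (A + B) = A + B"
    using assms(1,2) by (intro eq_matI) (auto simp: mat_adjoint_def mat_of_rows_def)
  thus ?thesis using assms(1,2) by (auto simp: hermitian_mat_def)
qed

theorem theorem1:
  fixes n k k' :: nat and C D :: "complex mat"
  assumes "1 \<le> n"
    and "C \<in> carrier_mat n n" and "hermitian_mat C" and "circulant_mat C"
    and "D \<in> carrier_mat n n" and "real_diagonal_mat D"
    and "1 \<le> k" and "k \<le> n" and "1 \<le> k'" and "k' \<le> n" and "k * k' < n"
  shows "eig 1 (C + D) \<le> eig 1 C + eig 1 D
    - 1 / 2 * min (eig 1 D - eig k D) (eig 1 C - eig k' C)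
        * (1 - sqrt (real (k * k') / real n))\<^sup>2"
proof -
  note C = assms(2-4) and D = assms(5,6) and k = assms(7,8) and k' = assms(9,10)
  have n: "n > 0" using assms(1) by simp
  have Dh: "hermitian_mat D" using D(2) by (rule real_diagonal_mat_hermitian)
  have CD: "C + D \<in> carrier_mat n n" using C(1) D(1) by simp
  obtain v where v0: "energy {..<n} v > 0"
    and v: "\<And>i. i < n \<Longrightarrow> (\<Sum>l<n. (C + D) $$ (i, l) * v l) = complex_of_real (eig 1 (C + D)) * v i"
    using eig_one_eigenvector[OF CD hermitian_mat_add[OF C(1) D(1) C(2) Dh] n] by blast
  define N where "N = energy {..<n} v"
  define z where "z = (\<lambda>j. \<Sum>l<n. cnj (fourier n l j) * v l)"
  have W: "orthonormal_columns n (fourier n)" using n by (rule orthonormal_columns_fourier)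
  have vz: "v i = (\<Sum>j<n. fourier n i j * z j)" if "i < n" for i
    unfolding z_def by (rule orthonormal_columns_expansion[OF W that])
  obtain T where T: "T \<subseteq> {..<n}" "card T < k'"
    and rC: "Re (\<Sum>i<n. cnj (v i) * (\<Sum>l<n. C $$ (i, l) * v l))
      \<le> eig 1 C * N - (eig 1 C - eig k' C) * (N - energy T z)"
    unfolding N_def
    by (rule rayleigh_gap_bound[OF C(1,2) W circulant_mult_fourier[OF C(1,3)] vz k'])
  \<comment> \<open>\<open>D\<close> is diagonal in the standard basis, where the coefficients of \<open>v\<close> are its own entries.\<close>
  define I where "I = (\<lambda>i j :: nat. if i = j then 1 else 0 :: complex)"
  have I: "orthonormal_columns n I"
    by (auto simp: orthonormal_columns_def I_def if_distrib cong: if_cong)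
  have vI: "v i = (\<Sum>j<n. I i j * v j)" if "i < n" for i
    using that by (simp add: I_def if_distrib[of "\<lambda>x. x * _"] cong: if_cong)
  have eI: "(\<Sum>l<n. D $$ (i, l) * I l j) = D $$ (j, j) * I i j" if "i < n" "j < n" for i j
    using that D by (auto simp: I_def real_diagonal_mat_def diagonal_mat_def if_distrib cong: if_cong)
  obtain S where S: "S \<subseteq> {..<n}" "card S < k"
    and rD: "Re (\<Sum>i<n. cnj (v i) * (\<Sum>l<n. D $$ (i, l) * v l))
      \<le> eig 1 D * N - (eig 1 D - eig k D) * (N - energy S v)"
    unfolding N_def
    by (rule rayleigh_gap_bound[OF D(1) Dh I eI vI k])
  define m where "m = min (eig 1 D - eig k D) (eig 1 C - eig k' C)"
  define s where "s = sqrt (real (k * k') / real n)"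
  have m0: "m \<ge> 0"
    using eig_antimono[OF C(1) k'] eig_antimono[OF D(1) k] by (simp add: m_def)
  have s01: "0 \<le> s" "s \<le> 1" using assms(11) by (auto simp: s_def simp del: of_nat_mult)
  have "energy S v + energy T z \<le> (1 + sqrt (1 / real n * real (card S * card T))) * N"
    unfolding N_def by (rule uncertainty[OF W vz S(1) T(1)]) (simp_all add: norm_fourier n)
  also have "\<dots> \<le> (1 + s) * N"
  proof -
    have "card S * card T \<le> k * k'" using S T by (intro mult_mono) auto
    hence "real (card S * card T) \<le> real (k * k')" by (rule of_nat_mono)
    hence "1 / real n * real (card S * card T) \<le> real (k * k') / real n"
      using n by (simp add: field_simps del: of_nat_mult)
    hence "sqrt (1 / real n * real (card S * card T)) \<le> s"
      unfolding s_def by (rule real_sqrt_le_mono)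
    thus ?thesis using v0 by (intro mult_right_mono) (auto simp: N_def)
  qed
  finally have unc: "(1 - s) * N \<le> (N - energy S v) + (N - energy T z)"
    by (simp add: algebra_simps)
  have S0: "N - energy S v \<ge> 0" unfolding N_def using energy_mono[OF _ S(1)] by simp
  have "energy T z \<le> energy {..<n} z" using energy_mono[OF _ T(1)] by simp
  also have "\<dots> = energy {..<n} (\<lambda>i. \<Sum>j<n. fourier n i j * z j)"
    by (rule energy_isometry[OF W, symmetric])
  also have "\<dots> = N" unfolding N_def by (simp add: energy_def vz)
  finally have T0: "N - energy T z \<ge> 0" by simp
  have "complex_of_real (eig 1 (C + D) * N) = (\<Sum>i<n. cnj (v i) * (\<Sum>l<n. (C + D) $$ (i, l) * v l))"
    unfolding of_real_mult N_def energy_eq_inner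
    by (subst sum_distrib_left, intro sum.cong refl) (simp only: lessThan_iff v mult.left_commute)
  also have "\<dots> = (\<Sum>i<n. cnj (v i) * (\<Sum>l<n. C $$ (i, l) * v l))
      + (\<Sum>i<n. cnj (v i) * (\<Sum>l<n. D $$ (i, l) * v l))"
    unfolding sum.distrib[symmetric]
    by (intro sum.cong refl) (use C(1) D(1) in \<open>simp add: ring_distribs sum.distrib\<close>)
  finally have "eig 1 (C + D) * N = Re (\<Sum>i<n. cnj (v i) * (\<Sum>l<n. C $$ (i, l) * v l))
      + Re (\<Sum>i<n. cnj (v i) * (\<Sum>l<n. D $$ (i, l) * v l))"
    by (metis Re_complex_of_real plus_complex.sel(1))
  also have "\<dots> \<le> (eig 1 C * N - (eig 1 C - eig k' C) * (N - energy T z))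
      + (eig 1 D * N - (eig 1 D - eig k D) * (N - energy S v))"
    using rC rD by (rule add_mono)
  also have "\<dots> \<le> (eig 1 C * N - m * (N - energy T z)) + (eig 1 D * N - m * (N - energy S v))"
    using S0 T0 by (intro add_mono diff_left_mono mult_right_mono) (auto simp: m_def)
  also have "\<dots> = (eig 1 C + eig 1 D) * N - m * ((N - energy S v) + (N - energy T z))"
    by (simp add: algebra_simps)
  also have "\<dots> \<le> (eig 1 C + eig 1 D) * N - m * ((1 - s) * N)"
    using unc m0 by (intro diff_left_mono mult_left_mono)
  also have "\<dots> = (eig 1 C + eig 1 D - m * (1 - s)) * N" by (simp add: algebra_simps)
  finally have "eig 1 (C + D) \<le> eig 1 C + eig 1 D - m * (1 - s)"
    using v0 by (simp add: N_def)
  also have "1 / 2 * (1 - s)\<^sup>2 \<le> 1 - s"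
    using mult_left_mono[of "1 - s" 2 "1 - s"] s01 by (simp add: power2_eq_square)
  hence "eig 1 C + eig 1 D - m * (1 - s) \<le> eig 1 C + eig 1 D - m * (1 / 2 * (1 - s)\<^sup>2)"
    using m0 by (intro diff_left_mono mult_left_mono)
  finally show ?thesis by (simp add: m_def s_def mult_ac)
qed

end
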